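(* For $n\ge6$, the characteristic polynomial of the Coxeter transformation of the diagram $T_{2,3,n-3}$ (also denoted $E_n$), taken up to the sign $(-1)^n$, is $$\chi(T_{2,3,n-3})=\chi(E_n)=\lambda^n+\lambda^{n-1}-\sum_{i=3}^{n-3}\lambda^i+\lambda+1,$$ in other words, $$\chi(T_{2,3,n-3})=\frac{\lambda^{n-2}(\lambda^3-\lambda-1)+(\lambda^3+\lambda^2-1)}{\lambda-1}.$$ As $n\to\infty$, the spectral radius $\rho(T_{2,3,n-3})$ of the Coxeter transformation converges to the maximal root $\rho_{max}$ of the equation $\lambda^3-\lambda-1=0$, and $$\rho_{max}=\sqrt[3]{\tfrac12+\sqrt{\tfrac{23}{108}}}+\sqrt[3]{\tfrac12-\sqrt{\tfrac{23}{108}}}\approx1.324717.$$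
   Context: $T_{p,q,r}$ is the simply-laced star-shaped tree with three branches having $p,q,r$ vertices respectively, each count including the common branch vertex (so $p+q+r-2$ vertices in total). The Coxeter transformation of a tree with Cartan matrix $K$ is the product of all simple reflections $\sigma_v(z)=z-(Kz)_v\alpha_v$, each taken once, in some order; for a tree all such products are conjugate. "Maximal root" means the largest real root. *)

theory Defs
  imports Complex_Main "Jordan_Normal_Form.Char_Poly" "Jordan_Normal_Form.Spectral_Radius"
begin

(* Vertices of T_{p,q,r} (p, q, r >= 1) are 0, ..., p+q+r-3.  Vertex 0 is the branch vertex, and
   without it the three branches are the chains 1..p-1, p..p+q-2 and p+q-1..p+q+r-3, listed
   outwards.  star_parent gives the neighbour of a vertex j >= 1 on the path to vertex 0. *)
definition star_parent :: "nat \<Rightarrow> nat \<Rightarrow> nat \<Rightarrow> nat" where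
  "star_parent p q j = (if j = 1 \<or> j = p \<or> j = p + q - 1 then 0 else j - 1)"

definition star_adj :: "nat \<Rightarrow> nat \<Rightarrow> nat \<Rightarrow> nat \<Rightarrow> bool" where
  "star_adj p q i j \<longleftrightarrow> (0 < j \<and> i = star_parent p q j) \<or> (0 < i \<and> j = star_parent p q i)"

definition cartan_matrix :: "nat \<Rightarrow> (nat \<Rightarrow> nat \<Rightarrow> bool) \<Rightarrow> real mat" where
  "cartan_matrix n adj = mat n n (\<lambda>(i, j). if i = j then 2 else if adj i j then - 1 else 0)"

definition star_cartan :: "nat \<Rightarrow> nat \<Rightarrow> nat \<Rightarrow> real mat" where
  "star_cartan p q r = cartan_matrix (p + q + r - 2) (star_adj p q)"

definition simple_reflection :: "real mat \<Rightarrow> nat \<Rightarrow> real vec \<Rightarrow> real vec" where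
  "simple_reflection K v z = z - ((K *\<^sub>v z) $ v) \<cdot>\<^sub>v unit_vec (dim_row K) v"

definition reflection_product :: "real mat \<Rightarrow> nat list \<Rightarrow> real vec \<Rightarrow> real vec" where
  "reflection_product K vs = foldr (\<circ>) (map (simple_reflection K) vs) id"

definition standard_matrix :: "nat \<Rightarrow> (real vec \<Rightarrow> real vec) \<Rightarrow> real mat" where
  "standard_matrix n f = mat n n (\<lambda>(i, j). f (unit_vec n j) $ i)"

(* C is, in the basis of simple roots, the matrix of a Coxeter transformation for the Cartan
   matrix K: the list vs is the order in which the simple reflections are multiplied. *)
definition is_coxeter_transformation :: "real mat \<Rightarrow> real mat \<Rightarrow> bool" where
  "is_coxeter_transformation K C \<longleftrightarrow>
     (\<exists>vs. distinct vs \<and> set vs = {..<dim_row K} \<and>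
           C = standard_matrix (dim_row K) (reflection_product K vs))"

definition is_maximal_root :: "real poly \<Rightarrow> real \<Rightarrow> bool" where
  "is_maximal_root f \<rho> \<longleftrightarrow> poly f \<rho> = 0 \<and> (\<forall>x. poly f x = 0 \<longrightarrow> x \<le> \<rho>)"

(* The indeterminate.  The library's char_poly A is the monic det (X I - A), that is,
   (-1)^n det (A - X I) for an n x n matrix A. *)
abbreviation X :: "real poly" where
  "X \<equiv> [:0, 1:]"

end

theory Submission
  imports Defs
begin

text \<open>
  Number the vertices by the order in which their reflections are multiplied and split the Cartan
  matrix as \<open>K = U + L\<close>, where \<open>U\<close> and \<open>L\<close> have ones on the diagonal and contain the entries
  of \<open>K\<close> above, respectively below, the diagonal. A reflection changes one coordinate only, and it
  reads off the new values of the vertices already treated and the old values of the others. Hence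
  the Coxeter transformation \<open>C\<close> satisfies \<open>U C = - L\<close>
  (\<open>coxeter_transformation_triangular\<close>), and \<open>det U \<cdot> char_poly C = det (X U + L)\<close>.

  The determinant of a matrix supported on a tree can be expanded at a leaf (\<open>det_leaf\<close>). The
  expansion uses an off-diagonal entry only in its product with the opposite entry. In \<open>X U + L\<close>
  this product is \<open>X\<close> for every edge, whatever the order of the reflections, so the
  determinant depends on the tree alone. For \<open>E\<^sub>n\<close> the leaves of the long branch give the
  recurrence \<open>D\<^sub>m\<^sub>+\<^sub>2 = (x + 1) D\<^sub>m\<^sub>+\<^sub>1 - x D\<^sub>m\<close>, and solving it gives the polynomial
  (\<open>det_E_shape\<close>). The same lemma with \<open>x = 0\<close> shows \<open>det U = 1\<close>.

  For the limit, let \<open>f z = z\<^sup>3 - z - 1\<close> and let \<open>\<rho>\<close> be its real root. The eigenvalues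
  other than \<open>1\<close> are the zeros other than \<open>1\<close> of \<open>z^(n - 2) f z + (z\<^sup>3 + z\<^sup>2 - 1)\<close>. If
  \<open>|z| > \<rho>\<close>, then \<open>|f z| \<ge> f |z| > 0\<close>, and the first summand dominates for large \<open>n\<close>,
  uniformly on \<open>|z| \<ge> b\<close> for each \<open>b > \<rho>\<close> (\<open>no_zero_of_large_norm\<close>). Conversely, for
  \<open>1 < y < \<rho>\<close> and large \<open>n\<close> the expression is negative at \<open>y\<close> and positive at \<open>\<rho>\<close>, so there is
  a real eigenvalue between them (\<open>exists_zero_below_cubic_root\<close>). The value of \<open>\<rho>\<close> is Cardano's
  formula.
\<close>

section \<open>Determinants of matrices supported on a tree\<close>

lemma mat_delete_last:
  "mat_delete (mat (Suc n) (Suc n) g) n n = mat n n g"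
  by (auto simp: mat_delete_def)

lemma mat_delete_first:
  "mat_delete (mat (Suc n) (Suc n) g) 0 0 = mat n n (\<lambda>(i, j). g (Suc i, Suc j))"
  by (auto simp: mat_delete_def)

text \<open>
  The last index is a leaf attached to \<open>p\<close>: expand along the last row, and then expand the minor
  that belongs to \<open>p\<close> along the last column, which has a single nonzero entry left. The two
  cofactor signs multiply to \<open>- 1\<close>.
\<close>
lemma det_leaf:
  fixes g :: "nat \<times> nat \<Rightarrow> 'a :: comm_ring_1"
  assumes "p < n"
    and leaf: "\<And>j. j < n \<Longrightarrow> j \<noteq> p \<Longrightarrow> g (n, j) = 0 \<and> g (j, n) = 0"
  shows "det (mat (Suc n) (Suc n) g) =
    g (n, n) * det (mat n n g) - g (n, p) * g (p, n) * det (mat_delete (mat n n g) p p)"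
proof -
  let ?M = "mat (Suc n) (Suc n) g"
  let ?B = "mat_delete ?M n p"
  obtain m where n: "n = Suc m"
    using \<open>p < n\<close> by (cases n) auto
  have B: "?B \<in> carrier_mat n n"
    by (auto simp: mat_delete_def)
  have "det ?B = (\<Sum>i<n. ?B $$ (i, m) * cofactor ?B i m)"
    by (rule laplace_expansion_column[OF B]) (simp add: n)
  also have "\<dots> = (\<Sum>i<n. if i = p then g (p, n) * cofactor ?B p m else 0)"
    by (rule sum.cong) (use \<open>p < n\<close> leaf in \<open>auto simp: mat_delete_def n\<close>)
  also have "\<dots> = g (p, n) * cofactor ?B p m"
    using \<open>p < n\<close> by simp
  also have "cofactor ?B p m = (- 1) ^ (p + m) * det (mat_delete ?B p m)"
    by (simp add: cofactor_def)
  also have "mat_delete ?B p m = mat_delete (mat n n g) p p"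
    by (rule eq_matI) (use \<open>p < n\<close> in \<open>auto simp: mat_delete_def n\<close>)
  finally have B_det: "det ?B = g (p, n) * ((- 1) ^ (p + m) * det (mat_delete (mat n n g) p p))" .
  have "det ?M = (\<Sum>j<Suc n. ?M $$ (n, j) * cofactor ?M n j)"
    by (rule laplace_expansion_row) auto
  also have "\<dots> = (\<Sum>j<n. if j = p then g (n, p) * cofactor ?M n p else 0) + g (n, n) * cofactor ?M n n"
    unfolding sum.lessThan_Suc
    by (intro arg_cong2[of _ _ _ _ "(+)"] sum.cong) (use \<open>p < n\<close> leaf in auto)
  also have "\<dots> = g (n, p) * cofactor ?M n p + g (n, n) * cofactor ?M n n"
    using \<open>p < n\<close> by simp
  also have "cofactor ?M n n = det (mat n n g)"
    by (simp add: cofactor_def mat_delete_last)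
  also have "cofactor ?M n p = (- 1) ^ (n + p) * det ?B"
    by (simp add: cofactor_def)
  also have "\<dots> = - (g (p, n) * det (mat_delete (mat n n g) p p))"
  proof -
    have "n + p + (p + m) = Suc (2 * (p + m))"
      by (simp add: n)
    then have "(- 1 :: 'a) ^ (n + p) * (- 1) ^ (p + m) = - 1"
      unfolding power_add[symmetric] by (simp only: power_Suc power_mult) simp
    then show ?thesis
      unfolding B_det by (metis (no_types, lifting) mult.left_commute mult_minus1 mult.assoc)
  qed
  finally show ?thesis
    by (simp add: algebra_simps)
qed

text \<open>
  The formula comes from the recurrence of the long branch, whose characteristic roots are \<open>1\<close> and
  \<open>x\<close>; this is why \<open>x - 1\<close> times the determinant is a combination of \<open>x^(m - 2)\<close> and \<open>1\<close>. The
  initial values are the diagrams of type \<open>A\<^sub>4\<close> (\<open>m = 4\<close>, the long branch is missing) and \<open>D\<^sub>5\<close>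
  (\<open>m = 5\<close>). Only the products of opposite entries are prescribed, so that the lemma covers every
  order of the reflections at once; and \<open>x\<close> is arbitrary so that it covers both \<open>X U + L\<close>
  (\<open>x = X\<close>) and \<open>U\<close> (\<open>x = 0\<close>).
\<close>
lemma det_E_shape:
  fixes g :: "nat \<times> nat \<Rightarrow> 'a :: idom"
  assumes diag: "\<And>i. i < N \<Longrightarrow> g (i, i) = x + 1"
    and edge: "\<And>j. 0 < j \<Longrightarrow> j < N \<Longrightarrow> g (j, star_parent 2 3 j) * g (star_parent 2 3 j, j) = x"
    and non_edge: "\<And>i j. i < N \<Longrightarrow> j < N \<Longrightarrow> i \<noteq> j \<Longrightarrow> \<not> star_adj 2 3 i j \<Longrightarrow> g (i, j) = 0"
    and "4 \<le> m" "m \<le> N"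
  shows "(x - 1) * det (mat m m g) = x ^ (m - 2) * (x ^ 3 - x - 1) + (x ^ 3 + x ^ 2 - 1)"
proof -
  define D where "D m = det (mat m m g)" for m
  have step: "D (Suc k) = (x + 1) * D k - x * det (mat_delete (mat k k g) p p)"
    if "Suc k \<le> N" "0 < k" and p: "p = star_parent 2 3 k" for k p
  proof -
    have "p < k"
      using that by (auto simp: star_parent_def)
    moreover have "g (k, j) = 0 \<and> g (j, k) = 0" if "j < k" "j \<noteq> p" for j
    proof -
      have "star_parent 2 3 j \<noteq> k"
        using \<open>j < k\<close> by (auto simp: star_parent_def)
      then show ?thesis
        using that \<open>Suc k \<le> N\<close> by (intro conjI non_edge) (auto simp: star_adj_def p)
    qed
    ultimately have "D (Suc k) = g (k, k) * D k - g (k, p) * g (p, k) * det (mat_delete (mat k k g) p p)"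
      unfolding D_def by (rule det_leaf)
    then show ?thesis
      using edge[of k] diag[of k] that by simp
  qed
  \<comment> \<open>For these \<open>k\<close> the vertex \<open>k + 1\<close> hangs on \<open>k\<close>, so deleting both leaves an initial segment.\<close>
  have chain: "D (Suc (Suc k)) = (x + 1) * D (Suc k) - x * D k"
    if "Suc (Suc k) \<le> N" "k = 0 \<or> k = 2 \<or> 4 \<le> k" for k
    using step[of "Suc k" k] that by (auto simp: mat_delete_last D_def star_parent_def)
  have D0: "D 0 = 1"
    by (simp add: D_def)
  have D1: "D 1 = x + 1"
    using \<open>4 \<le> m\<close> \<open>m \<le> N\<close> diag[of 0] by (simp add: D_def det_single)
  have D2: "D 2 = (x + 1) ^ 2 - x"
    using chain[of 0] \<open>4 \<le> m\<close> \<open>m \<le> N\<close> D0 D1 by (simp add: numeral_2_eq_2)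
  have D3: "D 3 = (x + 1) * D 2 - x * (x + 1)"
    using step[of 2 0] \<open>4 \<le> m\<close> \<open>m \<le> N\<close> diag[of 1]
    by (simp add: numeral_3_eq_3 numeral_2_eq_2 mat_delete_first det_single star_parent_def)
  have D4: "D 4 = (x + 1) * D 3 - x * D 2"
    using chain[of 2] \<open>4 \<le> m\<close> \<open>m \<le> N\<close> by (simp add: eval_nat_numeral)
  have base4: "(x - 1) * D 4 = x ^ 5 - 1"
    unfolding D4 D3 D2 by (simp add: algebra_simps eval_nat_numeral)
  have D5: "D 5 = (x + 1) * D 4 - x * ((x + 1) ^ 3 - x * (x + 1))" if "5 \<le> N"
  proof -
    \<comment> \<open>Vertex 4 hangs on the branch vertex 0. Deleting both leaves the vertices 1, 2, 3 with the
      single edge between 2 and 3; \<open>h\<close> shifts their indices down by one.\<close>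
    define h where "h = (\<lambda>(i, j). g (Suc i, Suc j))"
    have h_diag: "h (i, i) = x + 1" if "i < 3" for i
      using diag[of "Suc i"] that \<open>5 \<le> N\<close> by (simp add: h_def)
    have h_zero: "h (i, j) = 0" if "i < 3" "j < 3" "i \<noteq> j" "{i, j} \<noteq> {1, 2}" for i j
      using non_edge[of "Suc i" "Suc j"] that \<open>5 \<le> N\<close>
      by (auto simp: h_def star_adj_def star_parent_def numeral_3_eq_3 numeral_2_eq_2 less_Suc_eq)
    have h_edge: "h (2, 1) * h (1, 2) = x"
      using edge[of 3] \<open>5 \<le> N\<close> by (simp add: h_def star_parent_def eval_nat_numeral)
    have h1: "det (mat 1 1 h) = x + 1"
      using h_diag[of 0] by (simp add: det_single)
    have h2: "det (mat 2 2 h) = (x + 1) ^ 2"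
      using det_leaf[of 0 1 h] h1 h_diag[of 1] h_zero[of 0 1]
      by (simp add: numeral_2_eq_2 power2_eq_square doubleton_eq_iff)
    have "h (2, j) = 0 \<and> h (j, 2) = 0" if "j < 2" "j \<noteq> 1" for j
      using h_zero[of j 2] h_zero[of 2 j] that by (auto simp: doubleton_eq_iff)
    then have "det (mat (Suc 2) (Suc 2) h) =
        h (2, 2) * det (mat 2 2 h) - h (2, 1) * h (1, 2) * det (mat_delete (mat 2 2 h) 1 1)"
      by (intro det_leaf) auto
    also have "mat_delete (mat 2 2 h) 1 1 = mat 1 1 h"
      using mat_delete_last[of 1 h] by (simp add: numeral_2_eq_2)
    finally have "det (mat 3 3 h) = (x + 1) * det (mat 2 2 h) - x * (x + 1)"
      using h_diag[of 2] by (simp only: h_edge h1) simp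
    then have "det (mat 3 3 h) = (x + 1) ^ 3 - x * (x + 1)"
      by (simp add: h2 power3_eq_cube power2_eq_square)
    moreover have "mat_delete (mat 4 4 g) 0 0 = mat 3 3 h"
      using mat_delete_first[of 3 g] by (simp add: h_def)
    ultimately show ?thesis
      using step[of 4 0] \<open>5 \<le> N\<close> by (simp add: star_parent_def)
  qed
  have base5: "(x - 1) * D 5 = x ^ 3 * (x ^ 3 - x - 1) + (x ^ 3 + x ^ 2 - 1)" if "5 \<le> N"
    unfolding D5[OF that] D4 D3 D2 by (simp add: algebra_simps eval_nat_numeral)
  have "(x - 1) * D m = x ^ (m - 2) * (x ^ 3 - x - 1) + (x ^ 3 + x ^ 2 - 1)"
    using \<open>4 \<le> m\<close> \<open>m \<le> N\<close>
  proof (induction m rule: less_induct)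
    case (less m)
    consider "m = 4" | "m = 5" | k where "m = Suc (Suc k)" "4 \<le> k"
      using less.prems(1) that(3)[of "m - 2"] by linarith
    then show ?case
    proof cases
      case 1
      then show ?thesis
        using base4 by (simp add: algebra_simps eval_nat_numeral)
    next
      case 2
      then show ?thesis
        using base5 less.prems by simp
    next
      case 3
      define l where "l = k - 2"
      have k: "k = Suc (Suc l)"
        using 3 by (simp add: l_def)
      have "(x - 1) * D m = (x + 1) * ((x - 1) * D (Suc k)) - x * ((x - 1) * D k)"
        unfolding \<open>m = Suc (Suc k)\<close>
        by (subst chain) (use 3 less.prems in \<open>auto simp: algebra_simps\<close>)
      also have "\<dots> = (x + 1) * (x ^ (k - 1) * (x ^ 3 - x - 1) + (x ^ 3 + x ^ 2 - 1))
          - x * (x ^ (k - 2) * (x ^ 3 - x - 1) + (x ^ 3 + x ^ 2 - 1))"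
        using less.IH[of "Suc k"] less.IH[of k] 3 less.prems by simp
      also have "\<dots> = x ^ (m - 2) * (x ^ 3 - x - 1) + (x ^ 3 + x ^ 2 - 1)"
        by (simp add: 3 k algebra_simps)
      finally show ?thesis .
    qed
  qed
  then show ?thesis
    by (simp add: D_def)
qed

section \<open>The characteristic polynomial of a Coxeter transformation\<close>

lemma reflection_product_Nil: "reflection_product K [] z = z"
  by (simp add: reflection_product_def)

lemma reflection_product_Cons:
  "reflection_product K (v # vs) z = simple_reflection K v (reflection_product K vs z)"
  by (simp add: reflection_product_def)

lemma reflection_product_append:
  "reflection_product K (us @ vs) z = reflection_product K us (reflection_product K vs z)"
  by (induction us) (simp_all add: reflection_product_Nil reflection_product_Cons)

lemma dim_reflection_product:
  "dim_vec z = dim_row K \<Longrightarrow> dim_vec (reflection_product K vs z) = dim_row K"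
  by (cases vs) (simp_all add: reflection_product_Nil reflection_product_Cons simple_reflection_def)

lemma simple_reflection_index:
  assumes "i < dim_row K"
  shows "simple_reflection K v z $ i = (if i = v then z $ i - (K *\<^sub>v z) $ i else z $ i)"
  using assms by (cases "v < dim_row K") (auto simp: simple_reflection_def unit_vec_def)

lemma reflection_product_index_other:
  "i < dim_row K \<Longrightarrow> i \<notin> set vs \<Longrightarrow> reflection_product K vs z $ i = z $ i"
  by (induction vs) (simp_all add: reflection_product_Nil reflection_product_Cons simple_reflection_index)

text \<open>
  In \<open>vs = us @ i # ys\<close> the reflections in \<open>ys\<close> are applied before the one at \<open>i\<close>. When \<open>i\<close> is
  reached, the coordinates in \<open>ys\<close> already have their final value, since every vertex occurs
  only once, and all others still have their initial value.
\<close>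
lemma reflection_product_index:
  assumes K: "K \<in> carrier_mat n n" and z: "z \<in> carrier_vec n"
    and vs: "distinct vs" "set vs = {..<n}" and k: "k < length vs" "vs ! k = i"
  defines "w \<equiv> reflection_product K vs z"
  shows "w $ i = z $ i - (\<Sum>t<n. K $$ (i, t) * (if t \<in> set (drop (Suc k) vs) then w $ t else z $ t))"
proof -
  define us where "us = take k vs"
  define ys where "ys = drop (Suc k) vs"
  define y where "y = reflection_product K ys z"
  have vs_eq: "vs = us @ i # ys"
    using id_take_nth_drop[OF k(1)] k(2) by (simp add: us_def ys_def)
  have i: "i < n" and i_new: "i \<notin> set us" "i \<notin> set ys"
    using vs vs_eq by auto
  have w: "w = reflection_product K us (simple_reflection K i y)"
    by (simp add: w_def vs_eq reflection_product_append reflection_product_Cons y_def)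
  have dim_y: "dim_vec y = n"
    using K z by (simp add: y_def dim_reflection_product)
  have y: "y $ t = (if t \<in> set ys then w $ t else z $ t)" if "t < n" for t
  proof (cases "t \<in> set ys")
    case True
    then have "t \<notin> set us" "t \<noteq> i"
      using vs(1) vs_eq by auto
    then show ?thesis
      using True that K by (simp add: w reflection_product_index_other simple_reflection_index)
  next
    case False
    then show ?thesis
      using that K by (simp add: y_def reflection_product_index_other)
  qed
  have "w $ i = y $ i - (K *\<^sub>v y) $ i"
    using i i_new K by (simp add: w reflection_product_index_other simple_reflection_index)
  also have "(K *\<^sub>v y) $ i = (\<Sum>t<n. K $$ (i, t) * y $ t)"
    using i K dim_y by (auto simp: scalar_prod_def atLeast0LessThan)
  also have "\<dots> = (\<Sum>t<n. K $$ (i, t) * (if t \<in> set ys then w $ t else z $ t))"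
    by (rule sum.cong) (simp_all add: y)
  also have "y $ i = z $ i"
    using y[OF i] i_new by simp
  finally show ?thesis
    by (simp add: ys_def)
qed

lemma coxeter_transformation_carrier:
  "is_coxeter_transformation K C \<Longrightarrow> K \<in> carrier_mat n n \<Longrightarrow> C \<in> carrier_mat n n"
  unfolding is_coxeter_transformation_def standard_matrix_def by (metis carrier_matD(1) mat_carrier)

text \<open>
  This is the identity \<open>U C = - L\<close>. Write \<open>w = C z\<close>. Since \<open>K\<^sub>i\<^sub>i = 2\<close>, the reflection at \<open>i\<close>
  turns \<open>z\<^sub>i\<close> into \<open>- z\<^sub>i\<close> before the neighbours contribute. Moving the contributions of the
  new values to the left gives \<open>w\<^sub>i + (\<Sum> K\<^sub>i\<^sub>t w\<^sub>t) = - z\<^sub>i - (\<Sum> K\<^sub>i\<^sub>t z\<^sub>t)\<close>, where the left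
  sum is over the \<open>t\<close> that come after \<open>i\<close> in the product and the right sum over those before it.
  The function \<open>pos\<close> gives the position of a vertex in the product.
\<close>
lemma coxeter_transformation_triangular:
  assumes K: "K \<in> carrier_mat n n" and diag: "\<forall>i<n. K $$ (i, i) = 2"
    and C: "is_coxeter_transformation K C"
  shows "\<exists>pos :: nat \<Rightarrow> nat. inj_on pos {..<n} \<and> (\<forall>i<n. \<forall>j<n.
      (\<Sum>t<n. (if i = t then 1 else if pos i < pos t then K $$ (i, t) else 0) * C $$ (t, j)) =
      - (if i = j then 1 else if pos j < pos i then K $$ (i, j) else 0))"
proof -
  obtain vs where vs: "distinct vs" "set vs = {..<n}"
      and C_eq: "C = standard_matrix n (reflection_product K vs)"
    using C K by (auto simp: is_coxeter_transformation_def)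
  have len: "length vs = n"
    using distinct_card[OF vs(1)] vs(2) by simp
  define pos where "pos = the_inv_into {..<n} ((!) vs)"
  have bij: "bij_betw ((!) vs) {..<n} {..<n}"
    using bij_betw_nth[OF vs(1)] vs(2) len by auto
  have pos: "pos i < n" "vs ! pos i = i" if "i < n" for i
    using bij that f_the_inv_into_f_bij_betw[OF bij] the_inv_into_into[of "(!) vs" "{..<n}" i "{..<n}"]
    by (auto simp: pos_def bij_betw_def)
  have pos_nth: "pos (vs ! k) = k" if "k < n" for k
    using bij that by (auto simp: pos_def bij_betw_def intro: the_inv_into_f_f)
  have inj: "inj_on pos {..<n}"
    by (rule inj_on_inverseI[of _ "(!) vs"]) (simp add: pos)
  have later: "t \<in> set (drop (Suc k) vs) \<longleftrightarrow> k < pos t" if "t < n" for t k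
  proof
    assume "t \<in> set (drop (Suc k) vs)"
    then obtain l where "l < n - Suc k" "drop (Suc k) vs ! l = t"
      by (metis in_set_conv_nth length_drop len)
    then have "Suc k + l < n" "vs ! (Suc k + l) = t"
      by (simp_all add: len)
    then show "k < pos t"
      using pos_nth[of "Suc k + l"] by auto
  next
    assume "k < pos t"
    then have "drop (Suc k) vs ! (pos t - Suc k) = t" "pos t - Suc k < length (drop (Suc k) vs)"
      using pos[OF that] by (auto simp: len)
    then show "t \<in> set (drop (Suc k) vs)"
      by (metis nth_mem)
  qed
  have "(\<Sum>t<n. (if i = t then 1 else if pos i < pos t then K $$ (i, t) else 0) * C $$ (t, j)) =
      - (if i = j then 1 else if pos j < pos i then K $$ (i, j) else 0)"
    if i: "i < n" and j: "j < n" for i j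
  proof -
    define z :: "real vec" where "z = unit_vec n j"
    define w where "w = reflection_product K vs z"
    have w_C: "C $$ (t, j) = w $ t" if "t < n" for t
      using that j by (simp add: C_eq standard_matrix_def w_def z_def)
    have z_index: "z $ t = (if t = j then 1 else 0)" if "t < n" for t
      using that j by (simp add: z_def)
    have cmp: "pos t \<noteq> pos i" if "t < n" "t \<noteq> i" for t
      using inj that i by (auto dest: inj_onD)
    have "w $ i = z $ i - (\<Sum>t<n. K $$ (i, t) * (if t \<in> set (drop (Suc (pos i)) vs) then w $ t else z $ t))"
      unfolding w_def using K vs pos[OF i] by (intro reflection_product_index) (auto simp: len z_def)
    also have "(\<Sum>t<n. K $$ (i, t) * (if t \<in> set (drop (Suc (pos i)) vs) then w $ t else z $ t)) =
        (\<Sum>t<n. (if i = t then 2 * z $ i else 0)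
          + (if i \<noteq> t \<and> pos i < pos t then K $$ (i, t) else 0) * w $ t
          + (if t = j then (if i \<noteq> j \<and> pos j < pos i then K $$ (i, j) else 0) else 0))"
      by (rule sum.cong) (use cmp i in \<open>auto simp: later diag z_index dest: less_imp_not_less\<close>)
    also have "\<dots> = 2 * z $ i + (\<Sum>t<n. (if i \<noteq> t \<and> pos i < pos t then K $$ (i, t) else 0) * w $ t)
        + (if i \<noteq> j \<and> pos j < pos i then K $$ (i, j) else 0)"
      using i j by (simp add: sum.distrib)
    finally have "w $ i + (\<Sum>t<n. (if i \<noteq> t \<and> pos i < pos t then K $$ (i, t) else 0) * w $ t) =
        - (if i = j then 1 else if pos j < pos i then K $$ (i, j) else 0)"
      using z_index[OF i] by auto
    moreover have "w $ i + (\<Sum>t<n. (if i \<noteq> t \<and> pos i < pos t then K $$ (i, t) else 0) * w $ t) =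
        (\<Sum>t<n. (if i = t then w $ i else 0) + (if i \<noteq> t \<and> pos i < pos t then K $$ (i, t) else 0) * w $ t)"
      using i by (simp add: sum.distrib)
    moreover have "\<dots> = (\<Sum>t<n. (if i = t then 1 else if pos i < pos t then K $$ (i, t) else 0) * C $$ (t, j))"
      by (rule sum.cong) (auto simp: w_C)
    ultimately show ?thesis
      by simp
  qed
  then show ?thesis
    using inj by (intro exI[of _ pos]) blast
qed

text \<open>Multiplying \<open>X I - C\<close> by \<open>U\<close> turns it into \<open>X U - U C = X U + L\<close>.\<close>
lemma char_poly_coxeter_transformation:
  assumes K: "K \<in> carrier_mat n n" and diag: "\<forall>i<n. K $$ (i, i) = 2"
    and C: "is_coxeter_transformation K C"
  shows "\<exists>pos :: nat \<Rightarrow> nat. inj_on pos {..<n} \<and>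
     det (mat n n (\<lambda>(i, j). if i = j then 1 else if pos i < pos j then [:K $$ (i, j):] else 0)) * char_poly C =
     det (mat n n (\<lambda>(i, j). if i = j then X + 1 else if pos i < pos j then X * [:K $$ (i, j):] else [:K $$ (i, j):]))"
proof -
  have C_dim: "C \<in> carrier_mat n n"
    by (rule coxeter_transformation_carrier[OF C K])
  obtain pos :: "nat \<Rightarrow> nat" where inj: "inj_on pos {..<n}"
    and UC: "\<forall>i<n. \<forall>j<n.
      (\<Sum>t<n. (if i = t then 1 else if pos i < pos t then K $$ (i, t) else 0) * C $$ (t, j)) =
      - (if i = j then 1 else if pos j < pos i then K $$ (i, j) else 0)"
    using coxeter_transformation_triangular[OF K diag C] by (elim exE conjE) (rule that)
  define u where "u i t = (if i = t then 1 else if pos i < pos t then K $$ (i, t) else 0)" for i t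
  define U where "U = mat n n (\<lambda>(i, j). if i = j then 1 else if pos i < pos j then [:K $$ (i, j):] else 0)"
  have U_index: "U $$ (i, t) = [:u i t:]" if "i < n" "t < n" for i t
    using that by (simp add: U_def u_def)
  have P: "char_poly_matrix C \<in> carrier_mat n n"
    using C_dim by simp
  have "U * char_poly_matrix C =
    mat n n (\<lambda>(i, j). if i = j then X + 1 else if pos i < pos j then X * [:K $$ (i, j):] else [:K $$ (i, j):])"
    (is "_ = ?R")
  proof (rule eq_matI)
    fix i j
    assume "i < dim_row ?R" "j < dim_col ?R"
    then have i: "i < n" and j: "j < n"
      by auto
    have "(U * char_poly_matrix C) $$ (i, j) = (\<Sum>t<n. U $$ (i, t) * char_poly_matrix C $$ (t, j))"
      using i j carrier_matD[OF P] by (simp add: scalar_prod_def atLeast0LessThan U_def)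
    also have "\<dots> = (\<Sum>t<n. (if t = j then [:u i j:] * X else 0) - [:u i t * C $$ (t, j):])"
    proof (rule sum.cong)
      fix t
      assume "t \<in> {..<n}"
      then have "char_poly_matrix C $$ (t, j) = (if t = j then X else 0) - [:C $$ (t, j):]"
        using j C_dim by (simp add: char_poly_matrix_def)
      then show "U $$ (i, t) * char_poly_matrix C $$ (t, j) =
          (if t = j then [:u i j:] * X else 0) - [:u i t * C $$ (t, j):]"
        using i \<open>t \<in> {..<n}\<close> by (simp add: U_index right_diff_distrib)
    qed simp
    also have "\<dots> = [:u i j:] * X - [:\<Sum>t<n. u i t * C $$ (t, j):]"
      using j by (simp add: sum_subtractf sum_to_poly)
    also have "(\<Sum>t<n. u i t * C $$ (t, j)) = - (if i = j then 1 else if pos j < pos i then K $$ (i, j) else 0)"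
      using UC i j by (simp add: u_def)
    also have "[:u i j:] * X - [:\<dots>:] = ?R $$ (i, j)"
    proof -
      have "pos i < pos j \<or> pos j < pos i" if "i \<noteq> j"
        using inj i j that by (metis inj_onD lessThan_iff linorder_neqE_nat)
      then show ?thesis
        using i j by (auto simp: u_def one_pCons simp del: pCons_one)
    qed
    finally show "(U * char_poly_matrix C) $$ (i, j) = ?R $$ (i, j)" .
  qed (use P in \<open>auto simp: U_def\<close>)
  then have "det U * char_poly C = det ?R"
    using det_mult[of U n "char_poly_matrix C"] P by (simp add: char_poly_def U_def)
  then show ?thesis
    using inj unfolding U_def by (intro exI[of _ pos] conjI)
qed

text \<open>
  Of two adjacent vertices one comes first, so \<open>U\<close> contains exactly one of the two entries \<open>- 1\<close> of
  an edge. The products of opposite entries are therefore \<open>0\<close> in \<open>U\<close> and \<open>(- X) (- 1) = X\<close> in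
  \<open>X U + L\<close>.
\<close>
lemma char_poly_coxeter_E:
  assumes "6 \<le> n" and C: "is_coxeter_transformation (star_cartan 2 3 (n - 3)) C"
  shows "(X - 1) * char_poly C = X ^ (n - 2) * (X ^ 3 - X - 1) + (X ^ 3 + X ^ 2 - 1)"
    and "C \<in> carrier_mat n n"
proof -
  define K where "K = star_cartan 2 3 (n - 3)"
  have K_eq: "K = cartan_matrix n (star_adj 2 3)"
    using \<open>6 \<le> n\<close> by (simp add: K_def star_cartan_def)
  have K: "K \<in> carrier_mat n n"
    by (simp add: K_eq cartan_matrix_def)
  have K_diag: "\<forall>i<n. K $$ (i, i) = 2"
    by (simp add: K_eq cartan_matrix_def)
  have K_edge: "K $$ (i, j) = -1" if "i < n" "j < n" "i \<noteq> j" "star_adj 2 3 i j" for i j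
    using that by (simp add: K_eq cartan_matrix_def)
  have K_zero: "K $$ (i, j) = 0" if "i < n" "j < n" "i \<noteq> j" "\<not> star_adj 2 3 i j" for i j
    using that by (simp add: K_eq cartan_matrix_def)
  show "C \<in> carrier_mat n n"
    by (rule coxeter_transformation_carrier[OF C[folded K_def] K])
  obtain pos :: "nat \<Rightarrow> nat" where inj: "inj_on pos {..<n}" and det_eq:
    "det (mat n n (\<lambda>(i, j). if i = j then 1 else if pos i < pos j then [:K $$ (i, j):] else 0)) * char_poly C =
     det (mat n n (\<lambda>(i, j). if i = j then X + 1 else if pos i < pos j then X * [:K $$ (i, j):] else [:K $$ (i, j):]))"
    (is "det (mat n n ?u) * _ = det (mat n n ?r)")
    using char_poly_coxeter_transformation[OF K K_diag C[folded K_def]]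
    by (elim exE conjE) (rule that)
  have parent: "star_parent 2 3 j < j" "star_adj 2 3 j (star_parent 2 3 j)" "star_adj 2 3 (star_parent 2 3 j) j"
    if "0 < j" for j
    using that by (auto simp: star_adj_def star_parent_def)
  have "?u (j, star_parent 2 3 j) * ?u (star_parent 2 3 j, j) = 0" if "0 < j" for j
    using parent[OF that] by auto
  then have "(0 - 1) * det (mat n n ?u) = (0 :: real poly) ^ (n - 2) * (0 ^ 3 - 0 - 1) + (0 ^ 3 + 0 ^ 2 - 1)"
    by (rule det_E_shape[where N = n, rotated]) (use \<open>6 \<le> n\<close> K_zero in auto)
  then have det_u: "det (mat n n ?u) = 1"
    using \<open>6 \<le> n\<close> by (simp add: power_0_left)
  have r_edge: "?r (j, star_parent 2 3 j) * ?r (star_parent 2 3 j, j) = X" if "0 < j" "j < n" for j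
  proof -
    define p where "p = star_parent 2 3 j"
    have p: "p < j" "p < n"
      using parent[OF that(1)] that(2) by (auto simp: p_def)
    have "pos j \<noteq> pos p"
      using inj p that by (metis inj_onD lessThan_iff less_irrefl)
    then show ?thesis
      using p that parent[OF that(1)] K_edge[of j p] K_edge[of p j]
      by (auto simp flip: p_def)
  qed
  have "(X - 1) * det (mat n n ?r) = X ^ (n - 2) * (X ^ 3 - X - 1) + (X ^ 3 + X ^ 2 - 1)"
  proof (rule det_E_shape[where N = n, OF _ r_edge])
    show "?r (i, j) = 0" if "i < n" "j < n" "i \<noteq> j" "\<not> star_adj 2 3 i j" for i j
      using that K_zero[OF that] by simp
  qed (use \<open>6 \<le> n\<close> in simp_all)
  then show "(X - 1) * char_poly C = X ^ (n - 2) * (X ^ 3 - X - 1) + (X ^ 3 + X ^ 2 - 1)"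
    using det_eq unfolding det_u by (simp only: mult_1)
qed

lemma E_polynomial_expanded:
  fixes x :: "'a :: comm_ring_1"
  assumes "6 \<le> n"
  shows "(x - 1) * (x ^ n + x ^ (n - 1) - (\<Sum>i = 3..n - 3. x ^ i) + x + 1) =
    x ^ (n - 2) * (x ^ 3 - x - 1) + (x ^ 3 + x ^ 2 - 1)"
proof -
  define k where "k = n - 6"
  have n: "n = k + 6"
    using assms by (simp add: k_def)
  have sum: "(x - 1) * (\<Sum>i = 3..k + 3. x ^ i) = x ^ (k + 4) - x ^ 3"
  proof (induction k)
    case (Suc k)
    have "(\<Sum>i = 3..Suc k + 3. x ^ i) = (\<Sum>i = 3..k + 3. x ^ i) + x ^ (k + 4)"
      by (simp add: numeral_eq_Suc)
    moreover have "x ^ (Suc k + 4) = x * x ^ (k + 4)"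
      by (simp only: add_Suc power_Suc)
    ultimately show ?case
      using Suc by (simp only:) (simp add: algebra_simps)
  qed (simp add: algebra_simps flip: power_Suc)
  have "(x - 1) * (x ^ n + x ^ (n - 1) - (\<Sum>i = 3..n - 3. x ^ i) + x + 1) =
     (x - 1) * (x ^ n + x ^ (n - 1) + x + 1) - (x - 1) * (\<Sum>i = 3..k + 3. x ^ i)"
    by (simp only: n) (simp add: algebra_simps)
  also have "\<dots> = x ^ (n - 2) * (x ^ 3 - x - 1) + (x ^ 3 + x ^ 2 - 1)"
  proof -
    have exps: "n - 1 = k + 5" "n - 2 = k + 4"
      by (simp_all add: n)
    show ?thesis
      unfolding sum exps unfolding n power_add
      by (simp add: algebra_simps power_numeral_reduce)
  qed
  finally show ?thesis .
qed

section \<open>The limit of the spectral radii\<close>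

text \<open>
  The two cube roots \<open>a\<close> and \<open>b\<close> satisfy \<open>a\<^sup>3 + b\<^sup>3 = 1\<close> and \<open>3 a b = 1\<close>, so that
  \<open>(a + b)\<^sup>3 = a\<^sup>3 + b\<^sup>3 + 3 a b (a + b)\<close> is the cubic equation for \<open>a + b\<close>.
\<close>
lemma cubic_root_Cardano:
  defines "r \<equiv> root 3 (1 / 2 + sqrt (23 / 108)) + root 3 (1 / 2 - sqrt (23 / 108))"
  shows "r ^ 3 - r - 1 = 0"
proof -
  define s where "s = sqrt (23 / 108)"
  define a where "a = root 3 (1 / 2 + s)"
  define b where "b = root 3 (1 / 2 - s)"
  have "a * b = root 3 ((1 / 2 + s) * (1 / 2 - s))"
    by (simp add: a_def b_def real_root_mult)
  also have "(1 / 2 + s) * (1 / 2 - s) = 1 / 4 - s ^ 2"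
    by (simp add: algebra_simps power2_eq_square)
  also have "\<dots> = (1 / 3) ^ 3"
    by (simp add: s_def power3_eq_cube)
  finally have ab: "a * b = 1 / 3"
    by (simp only: real_root_power_cancel odd_real_root_power_cancel odd_numeral)
  have "a ^ 3 + b ^ 3 = 1"
    by (simp add: a_def b_def odd_real_root_pow)
  moreover have "(a + b) ^ 3 = a ^ 3 + b ^ 3 + 3 * (a * b) * (a + b)"
    by (simp add: algebra_simps power3_eq_cube)
  ultimately have "(a + b) ^ 3 = 1 + (a + b)"
    using ab by simp
  then show ?thesis
    by (simp add: r_def a_def b_def s_def)
qed

text \<open>The only possible obstacle is \<open>- 1 < x < 0\<close>, where \<open>x\<^sup>3 - x = |x| (1 - x\<^sup>2) < 1\<close>.\<close>
lemma cubic_neg_on_le_1: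
  fixes x :: real
  assumes "x \<le> 1"
  shows "x ^ 3 - x - 1 < 0"
proof -
  have "- x * (1 - x ^ 2) < 1"
  proof (cases "\<bar>x\<bar> < 1")
    case True
    then have "0 \<le> 1 - x ^ 2" "1 - x ^ 2 \<le> 1"
      by (simp_all add: abs_square_le_1)
    then have "- x * (1 - x ^ 2) \<le> \<bar>x\<bar> * 1"
      by (intro mult_mono) auto
    then show ?thesis
      using True by simp
  next
    case False
    then have "x = 1 \<or> x \<le> - 1" "1 \<le> x ^ 2"
      using assms abs_square_less_1[of x] by auto
    then have "- x * (1 - x ^ 2) \<le> 0"
      by (auto intro: mult_nonpos_nonpos)
    then show ?thesis
      by simp
  qed
  then show ?thesis
    by (simp add: algebra_simps power2_eq_square power3_eq_cube)
qed

text \<open>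
  The quotient of the cubic by \<open>x - r\<close> is positive for \<open>x > 1\<close>, and to the left of \<open>1\<close> the cubic is
  negative anyway.
\<close>
lemma cubic_sign:
  fixes r x :: real
  assumes r: "r ^ 3 - r - 1 = 0"
  shows cubic_root_gt_1: "1 < r"
    and cubic_neg_below: "x < r \<Longrightarrow> x ^ 3 - x - 1 < 0"
    and cubic_pos_above: "r < x \<Longrightarrow> 0 < x ^ 3 - x - 1"
proof -
  show r1: "1 < r"
    using cubic_neg_on_le_1[of r] r by linarith
  have factor: "x ^ 3 - x - 1 = (x - r) * (x ^ 2 + x * r + (r ^ 2 - 1))"
    using r by (simp add: algebra_simps power2_eq_square power3_eq_cube)
  have pos: "0 < x ^ 2 + x * r + (r ^ 2 - 1)" if "1 < x"
  proof -
    have "0 < x * r" "0 \<le> x ^ 2" "1 < r ^ 2"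
      using that r1 by (simp_all add: one_less_power)
    then show ?thesis
      by linarith
  qed
  show "x ^ 3 - x - 1 < 0" if "x < r"
  proof (cases "x \<le> 1")
    case False
    then show ?thesis
      unfolding factor using pos that by (intro mult_neg_pos) auto
  qed (rule cubic_neg_on_le_1)
  show "0 < x ^ 3 - x - 1" if "r < x"
    unfolding factor using pos that r1 by (intro mult_pos_pos) auto
qed

text \<open>
  With \<open>f s = s\<^sup>3 - s - 1\<close>, the quotient \<open>f s / s\<^sup>3\<close> increases with \<open>s > 0\<close>, so the hypothesis
  \<open>large\<close>, which concerns the radius \<open>y\<close> only, carries over to all \<open>s = |z| \<ge> y\<close>. There
  \<open>|z^m f z| \<ge> s^m f s > 3 s\<^sup>3 \<ge> |z\<^sup>3 + z\<^sup>2 - 1|\<close>.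
\<close>
lemma no_zero_of_large_norm:
  fixes z :: complex and y :: real
  assumes y: "1 < y" and pos: "0 < y ^ 3 - y - 1" and large: "3 * y ^ 3 < y ^ m * (y ^ 3 - y - 1)"
    and z: "y \<le> norm z"
  shows "z ^ m * (z ^ 3 - z - 1) + (z ^ 3 + z ^ 2 - 1) \<noteq> 0"
proof
  define s where "s = norm z"
  have s: "1 < s" "y \<le> s"
    using y z by (auto simp: s_def)
  assume "z ^ m * (z ^ 3 - z - 1) + (z ^ 3 + z ^ 2 - 1) = 0"
  then have "norm (z ^ m * (z ^ 3 - z - 1)) = norm (z ^ 3 + z ^ 2 - 1)"
    by (metis add_eq_0_iff norm_minus_cancel)
  then have eq: "s ^ m * norm (z ^ 3 - z - 1) = norm (z ^ 3 + z ^ 2 - 1)"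
    by (simp add: norm_mult norm_power s_def)
  have "norm (z ^ 3) - norm z - norm (1 :: complex) \<le> norm (z ^ 3 - z - 1)"
    using norm_triangle_ineq2[of "z ^ 3 - z" 1] norm_triangle_ineq2[of "z ^ 3" z] by linarith
  then have lower: "s ^ 3 - s - 1 \<le> norm (z ^ 3 - z - 1)"
    by (simp add: norm_power s_def)
  have "norm (z ^ 3 + z ^ 2 - 1) \<le> norm (z ^ 3) + norm (z ^ 2) + norm (1 :: complex)"
    using norm_triangle_ineq4[of "z ^ 3 + z ^ 2" 1] norm_triangle_ineq[of "z ^ 3" "z ^ 2"] by linarith
  also have "\<dots> = s ^ 3 + s ^ 2 + 1"
    by (simp add: norm_power s_def)
  also have "\<dots> \<le> 3 * s ^ 3"
    using s(1) power_increasing[of 2 3 s] one_le_power[of s 3] by linarith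
  finally have upper: "norm (z ^ 3 + z ^ 2 - 1) \<le> 3 * s ^ 3" .
  have "(y ^ 3 - y - 1) * s ^ 3 \<le> (s ^ 3 - s - 1) * y ^ 3"
  proof -
    have "y ^ 2 \<le> s ^ 2" "y ^ 3 \<le> s ^ 3"
      using s y by (auto intro: power_mono)
    then have "0 \<le> s * y * (s ^ 2 - y ^ 2) + (s ^ 3 - y ^ 3)"
      using s y by simp
    then show ?thesis
      by (simp add: algebra_simps power2_eq_square power3_eq_cube)
  qed
  also have "\<dots> \<le> norm (z ^ 3 - z - 1) * y ^ 3"
    using lower y by (intro mult_right_mono) auto
  finally have "y ^ m * ((y ^ 3 - y - 1) * s ^ 3) \<le> s ^ m * (norm (z ^ 3 - z - 1) * y ^ 3)"
    by - (rule mult_mono, use s y pos power_mono[of y s m] in auto)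
  also have "\<dots> = norm (z ^ 3 + z ^ 2 - 1) * y ^ 3"
    using eq by (simp flip: mult.assoc)
  also have "\<dots> \<le> 3 * s ^ 3 * y ^ 3"
    using upper y by (intro mult_right_mono) auto
  finally have "(y ^ m * (y ^ 3 - y - 1)) * s ^ 3 \<le> (3 * y ^ 3) * s ^ 3"
    by (simp add: mult_ac)
  then show False
    using large s by simp
qed

text \<open>The hypothesis \<open>large\<close> says that the expression is negative at \<open>y\<close>; at \<open>r\<close> only the
  positive summand \<open>r\<^sup>3 + r\<^sup>2 - 1\<close> survives.\<close>
lemma exists_zero_below_cubic_root:
  fixes y r :: real
  assumes r: "r ^ 3 - r - 1 = 0" and y: "1 < y" "y < r"
    and large: "y ^ 3 + y ^ 2 - 1 < y ^ m * (1 + y - y ^ 3)"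
  obtains x where "y \<le> x" "x ^ m * (x ^ 3 - x - 1) + (x ^ 3 + x ^ 2 - 1) = 0"
proof -
  define g where "g x = x ^ m * (x ^ 3 - x - 1) + (x ^ 3 + x ^ 2 - 1)" for x :: real
  have "g y \<le> 0"
    using large by (simp add: g_def algebra_simps)
  moreover have "0 \<le> g r"
    using y one_le_power[of r 3] zero_le_power2[of r] by (simp add: g_def r add_increasing2)
  moreover have "\<forall>x. y \<le> x \<and> x \<le> r \<longrightarrow> isCont g x"
    unfolding g_def by (intro allI impI continuous_intros)
  ultimately obtain x where "y \<le> x" "g x = 0"
    using IVT[of g y 0 r] y by auto
  then show thesis
    using that by (simp add: g_def)
qed

lemma eventually_less_power_mult:
  fixes y c d :: real
  assumes "1 < y" "0 < c"
  shows "\<forall>\<^sub>F n in sequentially. d < y ^ (n - 2) * c"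
proof -
  obtain N where N: "d / c < y ^ N"
    using real_arch_pow[OF \<open>1 < y\<close>] by blast
  have "d < y ^ (n - 2) * c" if "N + 2 \<le> n" for n
  proof -
    have "y ^ N \<le> y ^ (n - 2)"
      using assms(1) that by (intro power_increasing) auto
    then have "d / c < y ^ (n - 2)"
      using N by linarith
    then show ?thesis
      using assms(2) by (simp add: pos_divide_less_eq)
  qed
  then show ?thesis
    by (auto simp: eventually_sequentially)
qed

text \<open>The point \<open>1\<close> is excluded because the right-hand side carries the extra factor \<open>z - 1\<close>.\<close>
lemma eigenvalue_coxeter_E:
  assumes "6 \<le> n" and C: "is_coxeter_transformation (star_cartan 2 3 (n - 3)) C"
    and "z \<noteq> 1"
  shows "eigenvalue (map_mat complex_of_real C) z \<longleftrightarrow>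
    z ^ (n - 2) * (z ^ 3 - z - 1) + (z ^ 3 + z ^ 2 - 1) = 0"
proof -
  interpret of_real_poly: map_poly_idom_hom complex_of_real ..
  have C_dim: "C \<in> carrier_mat n n"
    by (rule char_poly_coxeter_E(2)[OF assms(1,2)])
  have "eigenvalue (map_mat complex_of_real C) z \<longleftrightarrow> poly (char_poly (map_mat complex_of_real C)) z = 0"
    using C_dim by (intro eigenvalue_root_char_poly) auto
  also have "char_poly (map_mat complex_of_real C) = map_poly complex_of_real (char_poly C)"
    by (rule of_real_hom.char_poly_hom[OF C_dim])
  also have "poly (map_poly complex_of_real (char_poly C)) z = 0 \<longleftrightarrow>
      poly (map_poly complex_of_real ((X - 1) * char_poly C)) z = 0"
    using \<open>z \<noteq> 1\<close> by (simp add: of_real_poly.hom_mult hom_distribs del: mult_pCons_left)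
  also have "poly (map_poly complex_of_real ((X - 1) * char_poly C)) z =
      z ^ (n - 2) * (z ^ 3 - z - 1) + (z ^ 3 + z ^ 2 - 1)"
    unfolding char_poly_coxeter_E(1)[OF \<open>6 \<le> n\<close> C]
    by (simp add: hom_distribs del: mult_pCons_left)
  finally show ?thesis .
qed

lemma spectral_radius_coxeter_E_tendsto:
  fixes C :: "nat \<Rightarrow> real mat" and r :: real
  assumes r: "r ^ 3 - r - 1 = 0"
    and C: "\<And>n. 6 \<le> n \<Longrightarrow> is_coxeter_transformation (star_cartan 2 3 (n - 3)) (C n)"
  shows "(\<lambda>n. spectral_radius (map_mat complex_of_real (C n))) \<longlonglongrightarrow> r"
proof (rule order_tendstoI)
  have r1: "1 < r"
    by (rule cubic_root_gt_1[OF r])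
  have dim: "map_mat complex_of_real (C n) \<in> carrier_mat n n" if "6 \<le> n" for n
    using char_poly_coxeter_E(2)[OF that C[OF that]] by simp
  fix a
  assume "a < r"
  then obtain y where y: "max a 1 < y" "y < r"
    using dense[of "max a 1" r] r1 by auto
  have "0 < 1 + y - y ^ 3"
    using cubic_neg_below[OF r y(2)] by simp
  then have "\<forall>\<^sub>F n in sequentially. y ^ 3 + y ^ 2 - 1 < y ^ (n - 2) * (1 + y - y ^ 3)"
    using y by (intro eventually_less_power_mult) auto
  then show "\<forall>\<^sub>F n in sequentially. a < spectral_radius (map_mat complex_of_real (C n))"
    using eventually_ge_at_top[of 6]
  proof eventually_elim
    case (elim n)
    obtain x where x: "y \<le> x" "x ^ (n - 2) * (x ^ 3 - x - 1) + (x ^ 3 + x ^ 2 - 1) = 0"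
      using exists_zero_below_cubic_root[OF r _ y(2) elim(1)] y(1) by auto
    have "complex_of_real (x ^ (n - 2) * (x ^ 3 - x - 1) + (x ^ 3 + x ^ 2 - 1)) = 0"
      by (simp only: x(2) of_real_0)
    then have "eigenvalue (map_mat complex_of_real (C n)) (complex_of_real x)"
      using x(1) y(1) elim(2) by (subst eigenvalue_coxeter_E[OF _ C]) auto
    then have "norm (complex_of_real x) \<le> spectral_radius (map_mat complex_of_real (C n))"
      using elim(2)
      by (intro spectral_radius_mem_max(2)[OF dim[OF elim(2)]] imageI) (simp_all add: spectrum_def)
    then show ?case
      using x(1) y(1) by simp
  qed
next
  fix b
  assume "r < b"
  have b1: "1 < b"
    using cubic_root_gt_1[OF r] \<open>r < b\<close> by simp
  have pos: "0 < b ^ 3 - b - 1"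
    by (rule cubic_pos_above[OF r \<open>r < b\<close>])
  have "\<forall>\<^sub>F n in sequentially. 3 * b ^ 3 < b ^ (n - 2) * (b ^ 3 - b - 1)"
    by (rule eventually_less_power_mult[OF b1 pos])
  then show "\<forall>\<^sub>F n in sequentially. spectral_radius (map_mat complex_of_real (C n)) < b"
    using eventually_ge_at_top[of 6]
  proof eventually_elim
    case (elim n)
    have dim: "map_mat complex_of_real (C n) \<in> carrier_mat n n"
      using char_poly_coxeter_E(2)[OF elim(2) C[OF elim(2)]] by simp
    obtain z where z: "eigenvalue (map_mat complex_of_real (C n)) z"
        "spectral_radius (map_mat complex_of_real (C n)) = norm z"
      using spectral_radius_mem_max(1)[OF dim] elim(2) by (auto simp: spectrum_def)
    show ?case
    proof (rule ccontr)
      assume "\<not> ?thesis"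
      then have "b \<le> norm z"
        using z(2) by simp
      then show False
        using no_zero_of_large_norm[OF b1 pos elim(1)] z(1) b1
          eigenvalue_coxeter_E[OF elim(2) C[OF elim(2)], of z]
        by force
    qed
  qed
qed

theorem proposition4p15:
  shows "(\<forall>n\<ge>6. \<forall>C. is_coxeter_transformation (star_cartan 2 3 (n - 3)) C \<longrightarrow>
           char_poly C = X ^ n + X ^ (n - 1) - (\<Sum>i = 3..n - 3. X ^ i) + X + 1 \<and>
           (X - 1) dvd (X ^ (n - 2) * (X ^ 3 - X - 1) + (X ^ 3 + X ^ 2 - 1)) \<and>
           char_poly C = (X ^ (n - 2) * (X ^ 3 - X - 1) + (X ^ 3 + X ^ 2 - 1)) div (X - 1)) \<and>
         (\<exists>\<rho>max. is_maximal_root (X ^ 3 - X - 1) \<rho>max \<and>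
           (\<forall>C :: nat \<Rightarrow> real mat.
              (\<forall>n\<ge>6. is_coxeter_transformation (star_cartan 2 3 (n - 3)) (C n)) \<longrightarrow>
              (\<lambda>n. spectral_radius (map_mat complex_of_real (C n))) \<longlonglongrightarrow> \<rho>max) \<and>
           \<rho>max = root 3 (1 / 2 + sqrt (23 / 108)) + root 3 (1 / 2 - sqrt (23 / 108)) \<and>
           1.324717 \<le> \<rho>max \<and> \<rho>max < 1.324718)"
proof (rule conjI)
  have X1: "X - 1 \<noteq> 0"
    by (simp add: one_pCons)
  show "\<forall>n\<ge>6. \<forall>C. is_coxeter_transformation (star_cartan 2 3 (n - 3)) C \<longrightarrow>
           char_poly C = X ^ n + X ^ (n - 1) - (\<Sum>i = 3..n - 3. X ^ i) + X + 1 \<and>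
           (X - 1) dvd (X ^ (n - 2) * (X ^ 3 - X - 1) + (X ^ 3 + X ^ 2 - 1)) \<and>
           char_poly C = (X ^ (n - 2) * (X ^ 3 - X - 1) + (X ^ 3 + X ^ 2 - 1)) div (X - 1)"
  proof (intro allI impI)
    fix n :: nat and C
    assume n: "6 \<le> n" and C: "is_coxeter_transformation (star_cartan 2 3 (n - 3)) C"
    note prod = char_poly_coxeter_E(1)[OF n C]
    have "char_poly C = X ^ n + X ^ (n - 1) - (\<Sum>i = 3..n - 3. X ^ i) + X + 1"
      using prod E_polynomial_expanded[OF n, of X] X1 by (metis mult_left_cancel)
    then show "char_poly C = X ^ n + X ^ (n - 1) - (\<Sum>i = 3..n - 3. X ^ i) + X + 1 \<and>
           (X - 1) dvd (X ^ (n - 2) * (X ^ 3 - X - 1) + (X ^ 3 + X ^ 2 - 1)) \<and>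
           char_poly C = (X ^ (n - 2) * (X ^ 3 - X - 1) + (X ^ 3 + X ^ 2 - 1)) div (X - 1)"
      using prod X1 by (metis dvd_triv_left nonzero_mult_div_cancel_left)
  qed
  define r where "r = root 3 (1 / 2 + sqrt (23 / 108)) + root 3 (1 / 2 - sqrt (23 / 108))"
  have r: "r ^ 3 - r - 1 = 0"
    unfolding r_def by (rule cubic_root_Cardano)
  have "poly (X ^ 3 - X - 1) x = x ^ 3 - x - 1" for x
    by simp
  then have "is_maximal_root (X ^ 3 - X - 1) r"
    using r cubic_pos_above[OF r] unfolding is_maximal_root_def by (metis less_irrefl not_le_imp_less)
  moreover have "1.324717 \<le> r"
    using cubic_pos_above[OF r, of "1.324717"] by (rule_tac ccontr) (simp add: power3_eq_cube)
  moreover have "r < 1.324718"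
  proof (rule ccontr)
    assume "\<not> r < 1.324718"
    then have "r = 1.324718 \<or> 1.324718 < r"
      by linarith
    then have "(1.324718 :: real) ^ 3 - 1.324718 - 1 \<le> 0"
    proof (elim disjE)
      assume eq: "r = 1.324718"
      show ?thesis
        using r unfolding eq by linarith
    next
      assume "1.324718 < r"
      then show ?thesis
        by (intro less_imp_le cubic_neg_below[OF r])
    qed
    then show False
      by (simp add: power3_eq_cube)
  qed
  ultimately show "\<exists>\<rho>max. is_maximal_root (X ^ 3 - X - 1) \<rho>max \<and>
           (\<forall>C :: nat \<Rightarrow> real mat.
              (\<forall>n\<ge>6. is_coxeter_transformation (star_cartan 2 3 (n - 3)) (C n)) \<longrightarrow>
              (\<lambda>n. spectral_radius (map_mat complex_of_real (C n))) \<longlonglongrightarrow> \<rho>max) \<and>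
           \<rho>max = root 3 (1 / 2 + sqrt (23 / 108)) + root 3 (1 / 2 - sqrt (23 / 108)) \<and>
           1.324717 \<le> \<rho>max \<and> \<rho>max < 1.324718"
    using spectral_radius_coxeter_E_tendsto[OF r] r_def by blast
qed

end
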